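(* Let $P(q)=1+q^2+q^3+q^4+q^5+q^6+q^7+q^8+q^{10}$ and $D=(1-tq)(1-wq^4)(1-vq^6)(1-xq^9)$. The following identity holds: $$ \begin{aligned} 1&+q\frac{t}{1-tq}+q^4\frac{w+vq^2}{(1-tq)(1-wq^4)}+q^{9}\frac{x+q^2+v^2q^3+q^5}{(1-tq)(1-wq^4)(1-vq^6)}\\ &+q^{16}\frac{1+x^2q^2+q^3+xq^4+q^5+q^6+xq^7+q^8+q^{10}}{D}\\ &+q^{25}\frac{P(q)}{D(1-q^5)}+q^{36}\frac{P(q)}{D(1-q^5)(1-q^6)}+q^{49}\frac{P(q)}{D(1-q^5)(1-q^6)(1-q^7)}\\ &+q^{64}\frac{P(q)}{D(1-q^5)(1-q^6)(1-q^7)(1-q^8)}\\ &+\sum_{m=9}^\infty\frac{q^{m^2}}{(1-tq)(1-q^2)(1-q^3)(1-wq^4)(1-q^5)(1-vq^6)(1-q^7)(1-q^8)(1-xq^9)\prod_{i=10}^{m}(1-q^i)}\\ &=\frac{1}{(1-tq)(1-wq^4)(1-vq^6)(1-xq^9)}\prod_{k=2}^\infty\frac{1}{(1-q^{5k+1})(1-q^{5k+4})}. \end{aligned} $$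
   Context: The identity is one of formal power series in $q$ with coefficients in $\mathbb{Z}[t,w,v,x]$, where $t,w,v,x$ are indeterminates. Empty products are $1$. *)

theory Defs
  imports "HOL-Analysis.Infinite_Products" "HOL-Computational_Algebra.Polynomial"
    "HOL-Computational_Algebra.Formal_Power_Series"
begin

text \<open>
  The coefficient ring \<open>\<int>[t,w,v,x]\<close> is built one variable at a time, as
  \<open>\<int>[t][w][v][x]\<close>: the innermost polynomial variable is \<open>t\<close>, the outermost is \<open>x\<close>.
\<close>

type_synonym Z_twvx = "int poly poly poly poly"

definition indet_t :: Z_twvx where "indet_t = [:[:[:[:0, 1:]:]:]:]"
definition indet_w :: Z_twvx where "indet_w = [:[:[:0, 1:]:]:]"
definition indet_v :: Z_twvx where "indet_v = [:[:0, 1:]:]"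
definition indet_x :: Z_twvx where "indet_x = [:0, 1:]"

text \<open>
  The library division on power series needs an \<open>inverse\<close> operation on the coefficients, which
  \<open>\<int>[t,w,v,x]\<close> does not have. The fraction below is meant for denominators with constant
  coefficient \<open>1\<close>; these are invertible over any commutative ring, and the second
  argument of \<open>fps_right_inverse\<close> is the inverse of the constant coefficient.
\<close>

definition fps_fraction :: "'a::comm_ring_1 fps \<Rightarrow> 'a fps \<Rightarrow> 'a fps" (infixl \<open>\<oslash>\<close> 70)
  where "f \<oslash> g = f * fps_right_inverse g 1"

lemma fps_fraction_mult_cancel:
  fixes f g :: "'a::comm_ring_1 fps"
  assumes "fps_nth g 0 = 1"
  shows "(f \<oslash> g) * g = f"
proof -
  have "g * fps_right_inverse g 1 = 1"
    by (rule fps_right_inverse) (simp add: assms)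
  then show ?thesis
    by (simp add: fps_fraction_def mult.assoc mult.commute[of "fps_right_inverse g 1" g])
qed

end

theory Submission
  imports Defs
begin

text \<open>
  Put \<open>C = (1-q)(1-q\<^sup>4)(1-q\<^sup>6)(1-q\<^sup>9)\<close>. The left-hand side is \<open>C/D\<close> times the
  Rogers--Ramanujan series \<open>\<Sum>q\<^bsup>m\<^sup>2\<^esup> / (q;q)\<^sub>m\<close>: this holds term by term for \<open>m \<ge> 5\<close>, while the first
  five terms agree only after summation, where \<open>t, w, v, x\<close> cancel. The right-hand side is
  \<open>C/D\<close> times the full Rogers--Ramanujan product. The first Rogers--Ramanujan identity comes
  from applying Bailey's lemma twice to the finite Jacobi triple product at \<open>z = 1\<close>, which vanishes;
  the resulting theta series is summed by the triple product in base \<open>q\<^sup>5\<close> at \<open>z = q\<^sup>3\<close>. Limits are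
  taken as congruences modulo \<open>q\<^sup>N\<close>.
\<close>

section \<open>Gaussian binomials\<close>

text \<open>The finite Pochhammer symbol \<open>(q;q)_n\<close>. The base is any ring element, so
  that \<open>q ^ 5\<close> can serve as well.\<close>

definition qfac :: "'a::comm_ring_1 \<Rightarrow> nat \<Rightarrow> 'a" where
  "qfac q n = (\<Prod>i<n. 1 - q ^ Suc i)"

text \<open>Taking the q-Pascal rule as the definition avoids division and works over every
  commutative ring.\<close>

fun gauss_binomial :: "'a::comm_ring_1 \<Rightarrow> nat \<Rightarrow> nat \<Rightarrow> 'a" where
  "gauss_binomial q n 0 = 1"
| "gauss_binomial q 0 (Suc k) = 0"
| "gauss_binomial q (Suc n) (Suc k) = gauss_binomial q n k + q ^ Suc k * gauss_binomial q n (Suc k)"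

lemma qfac_0 [simp]: "qfac q 0 = 1"
  by (simp add: qfac_def)

lemma qfac_Suc: "qfac q (Suc n) = qfac q n * (1 - q ^ Suc n)"
  by (simp add: qfac_def)

lemma gauss_binomial_eq_0: "n < k \<Longrightarrow> gauss_binomial q n k = 0"
  by (induction q n k rule: gauss_binomial.induct) auto

text \<open>The quotient formula without division, by induction on \<open>m + k\<close>. With the
  q-Pascal rule it comes down to
  \<open>1 - q^(l+1) + q^(l+1) * (1 - q^m) = 1 - q^(m+l+1)\<close>.\<close>

lemma gauss_binomial_mult_qfac:
  "gauss_binomial q (m + k) k * (qfac q m * qfac q k) = qfac q (m + k)"
proof (induction "m + k" arbitrary: m k)
  case (Suc n)
  show ?case
  proof (cases k)
    case k: (Suc l)
    have n: "n = m + l"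
      using Suc.hyps(2) k by simp
    have 1: "gauss_binomial q (m + l) l * (qfac q m * qfac q l) = qfac q (m + l)"
      by (rule Suc.hyps(1)[OF n])
    \<comment> \<open>For \<open>m = 0\<close> both sides vanish: the Gaussian binomial on the left,
      the factor \<open>1 - q ^ m\<close> on the right.\<close>
    have 2: "gauss_binomial q (m + l) (Suc l) * (qfac q m * qfac q (Suc l)) = qfac q (m + l) * (1 - q ^ m)"
    proof (cases m)
      case (Suc p)
      have "gauss_binomial q (p + Suc l) (Suc l) * (qfac q p * qfac q (Suc l)) = qfac q (p + Suc l)"
        by (rule Suc.hyps(1)) (use n Suc in simp)
      then have "gauss_binomial q (p + Suc l) (Suc l) * (qfac q p * qfac q (Suc l)) * (1 - q ^ m)
          = qfac q (p + Suc l) * (1 - q ^ m)"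
        by simp
      then show ?thesis
        by (simp only: Suc qfac_Suc[of q p] add_Suc add_Suc_right mult_ac)
    qed (simp add: gauss_binomial_eq_0)
    have "gauss_binomial q (m + k) k * (qfac q m * qfac q k)
        = gauss_binomial q (m + l) l * (qfac q m * qfac q l) * (1 - q ^ Suc l)
          + q ^ Suc l * (gauss_binomial q (m + l) (Suc l) * (qfac q m * qfac q (Suc l)))"
      by (simp add: k qfac_Suc[of q l] algebra_simps)
    also have "\<dots> = qfac q (m + l) * (1 - q ^ Suc l + q ^ Suc l * (1 - q ^ m))"
      unfolding 1 2 by (simp add: algebra_simps)
    also have "\<dots> = qfac q (m + k)"
      by (simp add: k qfac_Suc power_add algebra_simps)
    finally show ?thesis .
  qed simp
qed simp

section \<open>The q-binomial theorem and the finite Jacobi triple product\<close>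

lemma Suc_choose_2: "Suc n choose 2 = n + (n choose 2)"
  by (simp add: numeral_2_eq_2)

text \<open>The homogeneous form in \<open>x\<close> and \<open>y\<close> allows
  \<open>y = q ^ n\<close> later. The induction splits off the factor \<open>i = 0\<close>, which
  replaces \<open>x\<close> by \<open>x * q\<close> in the remaining product.\<close>

theorem q_binomial_theorem:
  fixes q x y :: "'a::comm_ring_1"
  shows "(\<Prod>i<n. y + x * q ^ i) = (\<Sum>k\<le>n. q ^ (k choose 2) * gauss_binomial q n k * x ^ k * y ^ (n - k))"
proof (induction n arbitrary: x)
  case (Suc n)
  define c where "c = (\<lambda>k. q ^ ((k choose 2) + k) * gauss_binomial q n k * x ^ k)"
  have "(\<Prod>i<Suc n. y + x * q ^ i) = (y + x) * (\<Prod>i<n. y + (x * q) * q ^ i)"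
    by (subst prod.lessThan_Suc_shift) (simp add: mult_ac)
  also have "\<dots> = (y + x) * (\<Sum>k\<le>n. c k * y ^ (n - k))"
    by (subst Suc.IH) (simp add: c_def power_mult_distrib power_add mult_ac)
  also have "\<dots> = (\<Sum>k\<le>n. c k * y ^ (Suc n - k)) + (\<Sum>k\<le>n. x * c k * y ^ (n - k))"
    by (simp add: sum.distrib sum_distrib_left Suc_diff_le algebra_simps)
  also have "(\<Sum>k\<le>n. c k * y ^ (Suc n - k)) = (\<Sum>k\<le>Suc n. c k * y ^ (Suc n - k))"
    by (simp add: c_def gauss_binomial_eq_0)
  also have "\<dots> = y ^ Suc n + (\<Sum>k\<le>n. c (Suc k) * y ^ (n - k))"
    by (subst sum.atMost_Suc_shift) (simp add: c_def binomial_eq_0)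
  also have "\<dots> + (\<Sum>k\<le>n. x * c k * y ^ (n - k)) = y ^ Suc n + (\<Sum>k\<le>n. (c (Suc k) + x * c k) * y ^ (n - k))"
    by (simp add: sum.distrib distrib_right)
  also have "\<dots> = (\<Sum>k\<le>Suc n. q ^ (k choose 2) * gauss_binomial q (Suc n) k * x ^ k * y ^ (Suc n - k))"
    by (subst sum.atMost_Suc_shift)
      (simp add: c_def Suc_choose_2 binomial_eq_0 power_add algebra_simps)
  finally show ?case .
qed (simp add: binomial_eq_0)

lemma choose_2_add: "(m + n) choose 2 = (m choose 2) + (n choose 2) + m * n"
  by (induction n) (auto simp: Suc_choose_2 binomial_eq_0)

lemma square_eq_choose_2: "n * n = 2 * (n choose 2) + n"
  by (induction n) (auto simp: Suc_choose_2 binomial_eq_0)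

lemma sum_symmetric_fold:
  fixes f :: "nat \<Rightarrow> 'a::comm_monoid_add"
  shows "(\<Sum>k\<le>2*n. f k) = f n + (\<Sum>j=1..n. f (n + j) + f (n - j))"
proof -
  have "(\<Sum>k\<le>2*n. f k) = (\<Sum>k<n. f k) + (\<Sum>k=n..n+n. f k)"
    by (subst sum.union_disjoint[symmetric]) (auto intro!: sum.cong)
  also have "(\<Sum>k=n..n+n. f k) = (\<Sum>j\<in>{0..n}. f (n + j))"
    using sum.shift_bounds_cl_nat_ivl[of f 0 n n] by (simp add: add.commute)
  also have "\<dots> = f n + (\<Sum>j=1..n. f (n + j))"
    by (subst sum.atLeast_Suc_atMost) auto
  also have "(\<Sum>k<n. f k) = (\<Sum>j=1..n. f (n - j))"
    by (rule sum.reindex_bij_witness[of _ "\<lambda>j. n - j" "\<lambda>j. n - j"]) auto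
  finally show ?thesis
    by (simp add: sum.distrib add_ac)
qed

text \<open>
  With \<open>z' = q / z\<close>, this is the $q$-binomial theorem for
  \<open>\<Prod>i<2n. q\<^sup>n - z q\<^sup>i\<close>, divided by \<open>q\<close>-powers and \<open>(-z)\<^sup>n\<close>.
\<close>
theorem finite_jacobi_triple_product:
  fixes q z z' :: "'a::idom"
  assumes q: "z * z' = q" and nz: "q \<noteq> 0"
  shows "(\<Prod>i<n. (1 - z * q ^ i) * (1 - z' * q ^ i))
       = gauss_binomial q (2*n) n
         + (\<Sum>j=1..n. (-1) ^ j * q ^ (j choose 2)
             * (z ^ j * gauss_binomial q (2*n) (n + j) + z' ^ j * gauss_binomial q (2*n) (n - j)))"
    (is "?L = ?R")
proof -
  \<comment> \<open>\<open>A\<close> is the term \<open>k = n\<close> of the expansion without its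
    Gaussian binomial. It divides every term and is cancelled at the end; it is nonzero since
    \<open>z * z' = q\<close> is.\<close>
  define A where "A = q ^ (n choose 2) * q ^ (n * n) * (- z) ^ n"
  have "A \<noteq> 0"
    using assms by (auto simp: A_def)
  define f where "f k = q ^ (k choose 2) * gauss_binomial q (2*n) k * (- z) ^ k * (q ^ n) ^ (2*n - k)" for k
  have "(\<Prod>i<2*n. q ^ n + (- z) * q ^ i)
      = (\<Prod>i<n. q ^ n + (- z) * q ^ i) * (\<Prod>i=n..<n+n. q ^ n + (- z) * q ^ i)"
    by (subst prod.union_disjoint[symmetric]) (auto intro!: prod.cong)
  also have "(\<Prod>i=n..<n+n. q ^ n + (- z) * q ^ i) = (\<Prod>i<n. q ^ n * (1 - z * q ^ i))"
    using prod.shift_bounds_nat_ivl[of "\<lambda>i. q ^ n + (- z) * q ^ i" 0 n n]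
    by (simp add: power_add algebra_simps atLeast0LessThan)
  also have "\<dots> = q ^ (n * n) * (\<Prod>i<n. 1 - z * q ^ i)"
    by (simp add: prod.distrib power_mult)
  \<comment> \<open>Because \<open>q = z * z'\<close>, the lower half of the product yields the
    factors in \<open>z'\<close>, in reverse order.\<close>
  also have "(\<Prod>i<n. q ^ n + (- z) * q ^ i) = (\<Prod>i<n. (- z) * q ^ i * (1 - z' * q ^ (n - Suc i)))"
  proof (rule prod.cong)
    fix i assume "i \<in> {..<n}"
    then have "q ^ n = q * (q ^ i * q ^ (n - Suc i))"
      by (simp flip: power_add power_Suc)
    also have "\<dots> = (z * z') * (q ^ i * q ^ (n - Suc i))"
      by (simp add: q)
    finally show "q ^ n + (- z) * q ^ i = (- z) * q ^ i * (1 - z' * q ^ (n - Suc i))"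
      by (simp add: algebra_simps)
  qed simp
  also have "\<dots> = (- z) ^ n * (\<Prod>i<n. q ^ i) * (\<Prod>i<n. 1 - z' * q ^ i)"
    using prod.nat_diff_reindex[of "\<lambda>i. 1 - z' * q ^ i" n] by (simp only: prod.distrib) simp
  also have "(\<Prod>i<n. q ^ i) = q ^ (n choose 2)"
    by (induction n) (auto simp: Suc_choose_2 power_add binomial_eq_0 mult.commute)
  also have "(- z) ^ n * q ^ (n choose 2) * (\<Prod>i<n. 1 - z' * q ^ i) * (q ^ (n * n) * (\<Prod>i<n. 1 - z * q ^ i)) = A * ?L"
    by (simp add: A_def prod.distrib mult_ac)
  finally have "A * ?L = (\<Sum>k\<le>2*n. f k)"
    unfolding q_binomial_theorem f_def by simp
  also have "\<dots> = f n + (\<Sum>j=1..n. f (n + j) + f (n - j))"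
    by (rule sum_symmetric_fold)
  also have "f n = A * gauss_binomial q (2*n) n"
    by (simp add: f_def A_def power_mult mult_ac)
  also have "(\<Sum>j=1..n. f (n + j) + f (n - j))
      = (\<Sum>j=1..n. A * ((-1) ^ j * q ^ (j choose 2)
             * (z ^ j * gauss_binomial q (2*n) (n + j) + z' ^ j * gauss_binomial q (2*n) (n - j))))"
  proof (rule sum.cong)
    fix j assume "j \<in> {1..n}"
    then obtain m where n: "n = m + j"
      by (metis atLeastAtMost_iff le_add_diff_inverse2)
    have e1: "((n + j) choose 2) + n * (2*n - (n + j)) = (n choose 2) + n * n + (j choose 2)"
    proof -
      have "n * j + n * (2*n - (n + j)) = n * n"
        by (simp add: n algebra_simps)
      then show ?thesis
        by (simp add: choose_2_add)
    qed
    \<comment> \<open>Compared with \<open>e1\<close> the exponent has a surplus of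
      \<open>j\<close>. Below, \<open>q^j = z^j * z'^j\<close> supplies the \<open>j\<close> missing
      powers of \<open>z\<close> and leaves \<open>z'^j\<close>.\<close>
    have e2: "((n - j) choose 2) + n * (2*n - (n - j)) = (n choose 2) + n * n + (j choose 2) + j"
    proof -
      have "n * (2*n - (n - j)) = n * n + (m * j + j * j)"
        by (simp add: n algebra_simps)
      moreover have "(n choose 2) = (m choose 2) + (j choose 2) + m * j"
        by (simp add: n choose_2_add)
      ultimately show ?thesis
        using square_eq_choose_2[of j] by (simp add: n)
    qed
    have "f (n + j) = q ^ (((n + j) choose 2) + n * (2*n - (n + j))) * gauss_binomial q (2*n) (n + j) * (- z) ^ (n + j)"
      by (simp only: f_def power_mult power_add mult_ac)
    then have 1: "f (n + j) = A * ((-1) ^ j * q ^ (j choose 2) * (z ^ j * gauss_binomial q (2*n) (n + j)))"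
      unfolding e1 by (simp add: A_def power_add power_minus[of z] mult_ac)
    have "(- z) ^ n * z' ^ j * (- 1) ^ j = (- z) ^ m * ((- 1) * (- z) * z') ^ j"
      by (simp only: n power_add power_mult_distrib mult_ac)
    then have sgn: "(- z) ^ (n - j) * q ^ j = (- z) ^ n * z' ^ j * (- 1) ^ j"
      by (simp add: n q)
    have "f (n - j) = q ^ (((n - j) choose 2) + n * (2*n - (n - j))) * gauss_binomial q (2*n) (n - j) * (- z) ^ (n - j)"
      by (simp only: f_def power_mult power_add mult_ac)
    also have "\<dots> = q ^ (n choose 2) * q ^ (n * n) * q ^ (j choose 2) * gauss_binomial q (2*n) (n - j) * ((- z) ^ (n - j) * q ^ j)"
      unfolding e2 power_add by (simp only: mult_ac)
    finally have 2: "f (n - j) = A * ((-1) ^ j * q ^ (j choose 2) * (z' ^ j * gauss_binomial q (2*n) (n - j)))"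
      unfolding sgn A_def by (simp only: mult_ac)
    show "f (n + j) + f (n - j) = A * ((-1) ^ j * q ^ (j choose 2)
             * (z ^ j * gauss_binomial q (2*n) (n + j) + z' ^ j * gauss_binomial q (2*n) (n - j)))"
      unfolding 1 2 by (simp add: distrib_left)
  qed simp
  also have "A * gauss_binomial q (2*n) n + \<dots> = A * ?R"
    by (simp add: distrib_left sum_distrib_left)
  finally show ?thesis
    using \<open>A \<noteq> 0\<close> by simp
qed

section \<open>Bailey's lemma\<close>

abbreviation qfac_inv :: "'a::comm_ring_1 fps \<Rightarrow> nat \<Rightarrow> 'a fps" where
  "qfac_inv q n \<equiv> 1 \<oslash> qfac q n"

lemma fps_fraction_eqI:
  fixes f g h :: "'a::comm_ring_1 fps"
  assumes "h * g = f" "fps_nth g 0 = 1"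
  shows "f \<oslash> g = h"
proof -
  have "h = h * ((1 \<oslash> g) * g)"
    by (simp add: fps_fraction_mult_cancel assms(2))
  also have "\<dots> = (h * g) * (1 \<oslash> g)"
    by (simp add: mult_ac)
  also have "\<dots> = f \<oslash> g"
    by (simp add: assms(1) fps_fraction_def)
  finally show ?thesis ..
qed

lemma fps_nth_0_prod: "fps_nth (\<Prod>i\<in>A. f i) 0 = (\<Prod>i\<in>A. fps_nth (f i) 0 :: 'a::comm_ring_1)"
  by (induction A rule: infinite_finite_induct) auto

text \<open>The base is kept abstract to serve for \<open>fps_X\<close> and \<open>fps_X ^ 5\<close>
  alike. Constant coefficient zero makes every \<open>qfac q n\<close> invertible;
  \<open>q \<noteq> 0\<close> is what the triple product asks for.\<close>

locale q_series =
  fixes q :: "'a::idom fps"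
  assumes q_nth_0: "fps_nth q 0 = 0" and q_nonzero: "q \<noteq> 0"
begin

abbreviation "u \<equiv> qfac_inv q"

lemma qfac_nth_0: "fps_nth (qfac q n) 0 = 1"
  by (simp add: qfac_def fps_nth_0_prod q_nth_0)

lemma u_mult_qfac [simp]: "u n * qfac q n = 1"
  by (rule fps_fraction_mult_cancel) (rule qfac_nth_0)

lemma qfac_nonzero: "qfac q n \<noteq> 0"
  using u_mult_qfac[of n] by (metis mult_zero_right zero_neq_one)

lemma u_eq_u_Suc: "u n = (1 - q ^ Suc n) * u (Suc n)"
  by (rule fps_fraction_eqI) (use u_mult_qfac[of "Suc n"] in \<open>simp_all add: qfac_Suc qfac_nth_0 mult_ac\<close>)

lemma gauss_binomial_eq: "gauss_binomial q (m + k) k = qfac q (m + k) * (u m * u k)"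
proof -
  have "gauss_binomial q (m + k) k * (u m * qfac q m) * (u k * qfac q k)
      = gauss_binomial q (m + k) k * (qfac q m * qfac q k) * (u m * u k)"
    by (simp only: mult_ac)
  then show ?thesis
    unfolding gauss_binomial_mult_qfac by simp
qed

text \<open>The limit \<open>N \<rightarrow> \<infinity>\<close> of the $q$-Vandermonde identity for \<open>[M+N, M+c]\<^sub>q\<close>.\<close>
lemma q_vandermonde_limit:
  "(\<Sum>m\<le>M. q ^ (m * (m + c)) * gauss_binomial q M m * u (m + c)) = u (M + c)"
proof (induction M arbitrary: c)
  case (Suc M)
  define g where "g m = gauss_binomial q M m" for m
  have "(\<Sum>m\<le>Suc M. q ^ (m * (m + c)) * gauss_binomial q (Suc M) m * u (m + c))
      = u c + (\<Sum>m\<le>M. q ^ (Suc m * (Suc m + c)) * (g m + q ^ Suc m * g (Suc m)) * u (Suc m + c))"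
    by (subst sum.atMost_Suc_shift) (simp add: g_def)
  also have "\<dots> = (\<Sum>m\<le>M. q ^ (Suc m * (Suc m + c)) * g m * u (Suc m + c))
      + (u c + (\<Sum>m\<le>M. q ^ (Suc m * (Suc m + c)) * q ^ Suc m * g (Suc m) * u (Suc m + c)))"
    by (simp add: sum.distrib algebra_simps)
  also have "u c + (\<Sum>m\<le>M. q ^ (Suc m * (Suc m + c)) * q ^ Suc m * g (Suc m) * u (Suc m + c))
      = (\<Sum>m\<le>Suc M. q ^ (m * (m + c)) * q ^ m * g m * u (m + c))"
    by (subst sum.atMost_Suc_shift) (simp add: g_def)
  also have "\<dots> = (\<Sum>m\<le>M. q ^ (m * (m + c)) * q ^ m * g m * u (m + c))"
    by (simp add: g_def gauss_binomial_eq_0)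
  \<comment> \<open>By \<open>u_eq_u_Suc\<close> at \<open>m + c\<close>, the two sums combine term
    by term into the case \<open>M\<close> with \<open>Suc c\<close> in place of
    \<open>c\<close>.\<close>
  also have "(\<Sum>m\<le>M. q ^ (Suc m * (Suc m + c)) * g m * u (Suc m + c)) + \<dots>
      = (\<Sum>m\<le>M. q ^ (m * (m + Suc c)) * g m * u (m + Suc c))"
    unfolding sum.distrib[symmetric]
  proof (rule sum.cong)
    fix m
    have "Suc m * (Suc m + c) = m * (m + Suc c) + Suc (m + c)"
      by (simp add: algebra_simps)
    then have 1: "q ^ (Suc m * (Suc m + c)) = q ^ (m * (m + Suc c)) * q ^ Suc (m + c)"
      by (simp only: power_add)
    have 2: "q ^ (m * (m + c)) * q ^ m = q ^ (m * (m + Suc c))"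
      by (simp add: power_add algebra_simps)
    show "q ^ (Suc m * (Suc m + c)) * g m * u (Suc m + c) + q ^ (m * (m + c)) * q ^ m * g m * u (m + c)
        = q ^ (m * (m + Suc c)) * g m * u (m + Suc c)"
      unfolding 1 2 u_eq_u_Suc[of "m + c"] by (simp add: algebra_simps)
  qed simp
  also have "\<dots> = u (Suc M + c)"
    using Suc.IH[of "Suc c"] by (simp add: g_def)
  finally show ?case .
qed simp

text \<open>The sequence \<open>\<beta>\<close> of the Bailey pair with parameter
  \<open>a = 1\<close> that belongs to \<open>\<alpha>\<close>.\<close>

definition bailey :: "(nat \<Rightarrow> 'a fps) \<Rightarrow> nat \<Rightarrow> 'a fps" where
  "bailey \<alpha> n = (\<Sum>j\<le>n. \<alpha> j * u (n - j) * u (n + j))"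

text \<open>Bailey's lemma at \<open>a = 1\<close> with both free parameters sent to infinity. After
  exchanging the sums, the inner one is \<open>q_vandermonde_limit\<close> with
  \<open>M = n - j\<close> and \<open>c = 2 * j\<close>.\<close>

lemma bailey_lemma:
  "(\<Sum>s\<le>n. q ^ s\<^sup>2 * u (n - s) * bailey \<alpha> s) = bailey (\<lambda>j. q ^ j\<^sup>2 * \<alpha> j) n"
proof -
  have "(\<Sum>s\<le>n. q ^ s\<^sup>2 * u (n - s) * bailey \<alpha> s)
      = (\<Sum>s\<le>n. \<Sum>j\<le>s. q ^ s\<^sup>2 * u (n - s) * (\<alpha> j * u (s - j) * u (s + j)))"
    by (simp add: bailey_def sum_distrib_left)
  also have "\<dots> = (\<Sum>j\<le>n. \<Sum>s=j..n. q ^ s\<^sup>2 * u (n - s) * (\<alpha> j * u (s - j) * u (s + j)))"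
    by (subst sum.Sigma, simp, simp)+
      (rule sum.reindex_bij_witness[of _ "\<lambda>(j, s). (s, j)" "\<lambda>(s, j). (j, s)"]; auto)
  also have "\<dots> = (\<Sum>j\<le>n. q ^ j\<^sup>2 * \<alpha> j * u (n - j) * u (n + j))"
  proof (rule sum.cong)
    fix j assume "j \<in> {..n}"
    then obtain M where n: "n = M + j"
      by (metis atMost_iff le_add_diff_inverse2)
    have "(\<Sum>s=j..n. q ^ s\<^sup>2 * u (n - s) * (\<alpha> j * u (s - j) * u (s + j)))
        = (\<Sum>m\<le>M. q ^ (m + j)\<^sup>2 * u (M - m) * (\<alpha> j * u m * u (m + 2 * j)))"
      unfolding n by (rule sum.reindex_bij_witness[of _ "\<lambda>m. m + j" "\<lambda>s. s - j"]) (auto simp: mult_2 add.assoc)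
    \<comment> \<open>The square splits as \<open>(m + j)^2 = j^2 + m * (m + 2 * j)\<close>, and
      \<open>u (M - m) * u m\<close> is a Gaussian binomial times \<open>u M\<close>.\<close>
    also have "\<dots> = (\<Sum>m\<le>M. q ^ j\<^sup>2 * \<alpha> j * u M * (q ^ (m * (m + 2 * j)) * gauss_binomial q M m * u (m + 2 * j)))"
    proof (rule sum.cong)
      fix m assume "m \<in> {..M}"
      then have "gauss_binomial q M m = qfac q M * (u (M - m) * u m)"
        using gauss_binomial_eq[of "M - m" m] by simp
      then have 1: "u M * gauss_binomial q M m = u (M - m) * u m"
        using u_mult_qfac[of M] by (metis mult.assoc mult_1)
      have 2: "q ^ (m + j)\<^sup>2 = q ^ j\<^sup>2 * q ^ (m * (m + 2 * j))"
      proof -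
        have "(m + j)\<^sup>2 = j\<^sup>2 + m * (m + 2 * j)"
          by (simp add: power2_eq_square algebra_simps)
        then show ?thesis
          by (simp only: power_add)
      qed
      have "q ^ j\<^sup>2 * \<alpha> j * u M * (q ^ (m * (m + 2 * j)) * gauss_binomial q M m * u (m + 2 * j))
          = (q ^ j\<^sup>2 * q ^ (m * (m + 2 * j))) * \<alpha> j * (u M * gauss_binomial q M m) * u (m + 2 * j)"
        by (simp only: mult_ac)
      then show "q ^ (m + j)\<^sup>2 * u (M - m) * (\<alpha> j * u m * u (m + 2 * j))
          = q ^ j\<^sup>2 * \<alpha> j * u M * (q ^ (m * (m + 2 * j)) * gauss_binomial q M m * u (m + 2 * j))"
        unfolding 1 2 by (simp only: mult_ac)
    qed simp
    also have "\<dots> = q ^ j\<^sup>2 * \<alpha> j * u M * u (M + 2 * j)"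
      by (simp only: sum_distrib_left[symmetric] q_vandermonde_limit)
    finally show "(\<Sum>s=j..n. q ^ s\<^sup>2 * u (n - s) * (\<alpha> j * u (s - j) * u (s + j)))
        = q ^ j\<^sup>2 * \<alpha> j * u (n - j) * u (n + j)"
      by (simp add: n mult_2 add.assoc)
  qed simp
  finally show ?thesis
    by (simp add: bailey_def)
qed

text \<open>The two-sided theta series with terms \<open>(-1)^j * q^(j*(j-1)/2) * z^j\<close>,
  folded so that \<open>j\<close> and \<open>-j\<close> share one term; \<open>z'\<close> stands for
  \<open>q / z\<close>. Index 0 occurs only once.\<close>

definition theta_coeff :: "'a fps \<Rightarrow> 'a fps \<Rightarrow> nat \<Rightarrow> 'a fps" where
  "theta_coeff z z' j = (if j = 0 then 1 else (-1) ^ j * q ^ (j choose 2) * (z ^ j + z' ^ j))"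

text \<open>The finite triple product read as a Bailey pair: each Gaussian binomial at
  \<open>n + j\<close> or \<open>n - j\<close> is \<open>qfac q (2*n)\<close> times
  \<open>u (n - j) * u (n + j)\<close>.\<close>

lemma bailey_theta:
  assumes "z * z' = q"
  shows "qfac q (2*n) * bailey (theta_coeff z z') n = (\<Prod>i<n. (1 - z * q ^ i) * (1 - z' * q ^ i))"
proof -
  have gauss: "gauss_binomial q (2*n) (n + j) = qfac q (2*n) * (u (n - j) * u (n + j))"
      "gauss_binomial q (2*n) (n - j) = qfac q (2*n) * (u (n - j) * u (n + j))" if "j \<le> n" for j
    using gauss_binomial_eq[of "n - j" "n + j"] gauss_binomial_eq[of "n + j" "n - j"] that
    unfolding mult_2 by (simp_all add: mult_ac)
  have "(\<Prod>i<n. (1 - z * q ^ i) * (1 - z' * q ^ i))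
      = qfac q (2*n) * (u n * u n)
         + (\<Sum>j=1..n. (-1) ^ j * q ^ (j choose 2)
             * (z ^ j * gauss_binomial q (2*n) (n + j) + z' ^ j * gauss_binomial q (2*n) (n - j)))"
    unfolding finite_jacobi_triple_product[OF assms q_nonzero] using gauss[of 0] by simp
  also have "\<dots> = qfac q (2*n) * (theta_coeff z z' 0 * u n * u n
         + (\<Sum>j=1..n. theta_coeff z z' j * u (n - j) * u (n + j)))"
    unfolding distrib_left sum_distrib_left
  proof (intro arg_cong2[where f = "(+)"] sum.cong)
    fix j assume "j \<in> {1..n}"
    then have j: "j \<noteq> 0" "j \<le> n"
      by auto
    show "(-1) ^ j * q ^ (j choose 2)
             * (z ^ j * gauss_binomial q (2*n) (n + j)) + (-1) ^ j * q ^ (j choose 2) * (z' ^ j * gauss_binomial q (2*n) (n - j))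
        = qfac q (2*n) * (theta_coeff z z' j * u (n - j) * u (n + j))"
      unfolding gauss[OF j(2)] theta_coeff_def using j(1) by (simp add: algebra_simps)
  qed (simp_all add: theta_coeff_def mult_ac)
  also have "theta_coeff z z' 0 * u n * u n + (\<Sum>j=1..n. theta_coeff z z' j * u (n - j) * u (n + j))
      = bailey (theta_coeff z z') n"
    unfolding bailey_def atMost_atLeast0 by (subst (2) sum.atLeast_Suc_atMost) auto
  finally show ?thesis ..
qed

text \<open>At \<open>z = 1\<close> the factor \<open>i = 0\<close> kills the product for every
  \<open>n > 0\<close>, which gives the unit Bailey pair. Bailey's lemma turns it first into
  \<open>u n\<close>, then into the sum on the left.\<close>

theorem finite_rogers_ramanujan:
  "(\<Sum>s\<le>n. q ^ s\<^sup>2 * u s * u (n - s)) = bailey (\<lambda>j. q ^ (2 * j\<^sup>2) * theta_coeff 1 q j) n"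
proof -
  have 0: "bailey (theta_coeff 1 q) n = (if n = 0 then 1 else 0)" for n
  proof -
    have "(\<Prod>i<n. (1 - 1 * q ^ i) * (1 - q * q ^ i)) = (if n = 0 then 1 else 0)"
    proof (cases "n = 0")
      case False
      then show ?thesis
        by (auto intro!: prod_zero bexI[of _ 0])
    qed simp
    then have "qfac q (2*n) * bailey (theta_coeff 1 q) n = qfac q (2*n) * (if n = 0 then 1 else 0)"
      using bailey_theta[of 1 q n] by auto
    then show ?thesis
      using qfac_nonzero by simp
  qed
  have 1: "bailey (\<lambda>j. q ^ j\<^sup>2 * theta_coeff 1 q j) n = u n" for n
  proof -
    have "u n = (\<Sum>s\<le>n. q ^ s\<^sup>2 * u (n - s) * bailey (theta_coeff 1 q) s)"
      by (simp add: 0 sum.delta if_distrib cong: if_cong)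
    then show ?thesis
      by (simp add: bailey_lemma)
  qed
  have "(\<Sum>s\<le>n. q ^ s\<^sup>2 * u (n - s) * u s)
      = bailey (\<lambda>j. q ^ j\<^sup>2 * (q ^ j\<^sup>2 * theta_coeff 1 q j)) n"
    using bailey_lemma[of n "\<lambda>j. q ^ j\<^sup>2 * theta_coeff 1 q j"] by (simp only: 1)
  then show ?thesis
    by (simp add: mult_2 power_add mult_ac)
qed

end

section \<open>Congruence modulo powers of the variable\<close>

definition fps_cong :: "nat \<Rightarrow> 'a::comm_ring_1 fps \<Rightarrow> 'a fps \<Rightarrow> bool" where
  "fps_cong N f g \<longleftrightarrow> fps_X ^ N dvd f - g"

lemma fps_X_power_dvd_iff:
  fixes f :: "'a::comm_ring_1 fps"
  shows "fps_X ^ N dvd f \<longleftrightarrow> (\<forall>k<N. fps_nth f k = 0)"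
proof
  assume "\<forall>k<N. fps_nth f k = 0"
  then have "fps_cutoff N f = 0"
    by (simp add: fps_eq_iff)
  then show "fps_X ^ N dvd f"
    using fps_shift_cutoff'[of N f] by (metis add.right_neutral dvd_triv_left)
qed (auto simp: fps_X_power_mult_nth elim!: dvdE)

lemma fps_cong_iff: "fps_cong N f g \<longleftrightarrow> (\<forall>k<N. fps_nth f k = fps_nth g k)"
  by (simp add: fps_cong_def fps_X_power_dvd_iff)

lemma fps_cong_refl [simp]: "fps_cong N f f"
  by (simp add: fps_cong_iff)

lemma fps_cong_sym: "fps_cong N f g \<Longrightarrow> fps_cong N g f"
  by (simp add: fps_cong_iff)

lemma fps_cong_trans [trans]: "fps_cong N f g \<Longrightarrow> fps_cong N g h \<Longrightarrow> fps_cong N f h"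
  by (simp add: fps_cong_iff)

lemma fps_cong_mono: "fps_cong N f g \<Longrightarrow> M \<le> N \<Longrightarrow> fps_cong M f g"
  by (simp add: fps_cong_iff)

lemma fps_cong_0_iff: "fps_cong N f 0 \<longleftrightarrow> fps_X ^ N dvd f"
  by (simp add: fps_cong_def)

lemma fps_cong_diff: "fps_cong N f f' \<Longrightarrow> fps_cong N g g' \<Longrightarrow> fps_cong N (f - g) (f' - g')"
  by (simp add: fps_cong_iff)

lemma fps_cong_mult: "fps_cong N f f' \<Longrightarrow> fps_cong N g g' \<Longrightarrow> fps_cong N (f * g) (f' * g')"
  by (simp add: fps_cong_iff fps_mult_nth)

lemma fps_cong_sum: "(\<And>i. i \<in> A \<Longrightarrow> fps_cong N (f i) (g i)) \<Longrightarrow> fps_cong N (sum f A) (sum g A)"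
  by (simp add: fps_cong_iff fps_sum_nth)

lemma fps_cong_prod: "(\<And>i. i \<in> A \<Longrightarrow> fps_cong N (f i) (g i)) \<Longrightarrow> fps_cong N (prod f A) (prod g A)"
  by (induction A rule: infinite_finite_induct) (auto intro: fps_cong_mult)

lemma fps_cong_one_minus_X_power: "N \<le> m \<Longrightarrow> fps_cong N (1 - fps_X ^ m) 1"
  by (simp add: fps_cong_iff)

section \<open>Truncation of products and sums, and limits\<close>

lemma fps_cong_prod_truncate:
  assumes "N \<le> n" "\<And>i. N \<le> i \<Longrightarrow> fps_cong N (f i) 1"
  shows "fps_cong N (\<Prod>i<n. f i) (\<Prod>i<N. f i)"
proof -
  have "fps_cong N (\<Prod>i<n. f i) (\<Prod>i<n. if i \<in> {..<N} then f i else 1)"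
    by (rule fps_cong_prod) (use assms in auto)
  also have "(\<Prod>i<n. if i \<in> {..<N} then f i else 1) = (\<Prod>i<N. f i)"
    by (rule prod.mono_neutral_cong_right) (use assms(1) in auto)
  finally show ?thesis .
qed

text \<open>A formal dominated convergence: terms from \<open>N\<close> on are divisible by
  \<open>fps_X ^ N\<close>, and in the others \<open>v j\<close> may be replaced by its limit
  \<open>V\<close>.\<close>

lemma fps_cong_sum_truncate:
  assumes "N \<le> n" "\<And>j. fps_X ^ j dvd c j" "\<And>j. j < N \<Longrightarrow> fps_cong N (v j) V"
  shows "fps_cong N (\<Sum>j\<le>n. c j * v j) ((\<Sum>j<N. c j) * V)"
proof -
  have "fps_cong N (\<Sum>j\<le>n. c j * v j) (\<Sum>j\<le>n. if j < N then c j * V else 0)"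
  proof (rule fps_cong_sum)
    fix j
    have "fps_X ^ N dvd c j * v j" if "N \<le> j"
      using assms(2)[of j] that by (meson dvd_mult2 dvd_trans le_imp_power_dvd)
    then show "fps_cong N (c j * v j) (if j < N then c j * V else 0)"
      using assms(3) by (auto simp: fps_cong_0_iff intro: fps_cong_mult)
  qed
  also have "(\<Sum>j\<le>n. if j < N then c j * V else 0) = (\<Sum>j<N. c j * V)"
    by (rule sum.mono_neutral_cong_right) (use assms(1) in auto)
  finally show ?thesis
    by (simp add: sum_distrib_right)
qed

text \<open>Only the terms with \<open>n \<le> k\<close> contribute to coefficient \<open>k\<close>,
  so it is a finite sum.\<close>

lemma fps_series_limit_exists:
  fixes f :: "nat \<Rightarrow> 'a::comm_ring_1 fps"
  assumes "\<And>n. fps_X ^ n dvd f n"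
  obtains s where "\<And>N. fps_cong N (\<Sum>n<N. f n) s"
proof
  fix N
  show "fps_cong N (\<Sum>n<N. f n) (Abs_fps (\<lambda>k. \<Sum>n\<le>k. fps_nth (f n) k))"
    unfolding fps_cong_iff fps_sum_nth fps_nth_Abs_fps
  proof (intro allI impI)
    fix k assume "k < N"
    then show "(\<Sum>n<N. fps_nth (f n) k) = (\<Sum>n\<le>k. fps_nth (f n) k)"
      using assms by (intro sum.mono_neutral_right) (auto simp: fps_X_power_dvd_iff)
  qed
qed

text \<open>The passage from congruences to topological limits: coefficient \<open>k\<close> is
  constant once \<open>N > k\<close>.\<close>

lemma tendsto_fps_congI:
  assumes "\<And>N. fps_cong N (f N) l"
  shows "f \<longlonglongrightarrow> (l :: 'a::comm_ring_1 fps)"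
proof (rule tendsto_fpsI)
  fix k
  show "\<forall>\<^sub>F N in sequentially. fps_nth (f N) k = fps_nth l k"
    using eventually_gt_at_top[of k] by eventually_elim (use assms in \<open>auto simp: fps_cong_iff\<close>)
qed

section \<open>The first Rogers--Ramanujan identity\<close>

interpretation X: q_series "fps_X :: 'a::idom fps"
  by standard simp_all

interpretation X5: q_series "fps_X ^ 5 :: 'a::idom fps"
  by standard (simp_all add: fps_X_power_nth)

lemma fps_cong_qfac:
  assumes "N \<le> n" "0 < k"
  shows "fps_cong N (qfac (fps_X ^ k) n) (qfac (fps_X ^ k :: 'a::comm_ring_1 fps) N)"
  unfolding qfac_def
proof (rule fps_cong_prod_truncate)
  fix i assume "N \<le> i"
  then have "N \<le> k * Suc i"
    using mult_le_mono[of 1 k N "Suc i"] \<open>0 < k\<close> by simp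
  then show "fps_cong N (1 - (fps_X ^ k) ^ Suc i) (1 :: 'a fps)"
    unfolding power_mult[symmetric] by (rule fps_cong_one_minus_X_power)
qed fact

lemma fps_cong_qfac_inv:
  assumes "N \<le> n" "0 < k"
  shows "fps_cong N (qfac_inv (fps_X ^ k) n) (qfac_inv (fps_X ^ k :: 'a::idom fps) N)"
proof -
  interpret q_series "fps_X ^ k :: 'a fps"
    using assms(2) by unfold_locales auto
  \<comment> \<open>On the left \<open>u N\<close> cancels and leaves \<open>u n\<close>; on the
    right \<open>u n\<close> cancels and leaves \<open>u N\<close>.\<close>
  have "fps_cong N (u n * u N * qfac (fps_X ^ k) N) (u n * u N * qfac (fps_X ^ k) n)"
    by (intro fps_cong_mult fps_cong_refl fps_cong_sym[OF fps_cong_qfac] assms)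
  moreover have "u n * u N * qfac (fps_X ^ k) n = u N" "u n * u N * qfac (fps_X ^ k) N = u n"
    by (simp add: mult.left_commute[of "u n"] mult.assoc) (simp add: mult.assoc)
  ultimately show ?thesis
    by (simp only:)
qed

text \<open>The index \<open>2 * N\<close> ensures \<open>2 * N - j \<ge> N\<close> for all
  \<open>j < N\<close>, so both inverse factors have reached their limit modulo
  \<open>fps_X ^ N\<close>.\<close>

lemma fps_cong_bailey:
  assumes "0 < k" "\<And>j. fps_X ^ j dvd \<alpha> j"
  shows "fps_cong N (q_series.bailey (fps_X ^ k) \<alpha> (2 * N))
           ((\<Sum>j<N. \<alpha> j) * (qfac_inv (fps_X ^ k :: 'a::idom fps) N)\<^sup>2)"
proof -
  interpret q_series "fps_X ^ k :: 'a fps"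
    using assms(1) by unfold_locales auto
  have "fps_cong N (\<Sum>j\<le>2*N. \<alpha> j * (u (2 * N - j) * u (2 * N + j))) ((\<Sum>j<N. \<alpha> j) * (u N * u N))"
    by (intro fps_cong_sum_truncate fps_cong_mult fps_cong_qfac_inv assms) auto
  then show ?thesis
    by (simp add: bailey_def power2_eq_square mult.assoc)
qed

text \<open>The factors \<open>1 - q ^ i\<close> are sorted by the residue of \<open>i\<close>
  modulo 5: first 0, then 3 and 2, then 1 and 4.\<close>

lemma qfac_5_dissection:
  "qfac q (5 * n) = qfac (q ^ 5) n * (\<Prod>i<n. (1 - q ^ 3 * (q ^ 5) ^ i) * (1 - q ^ 2 * (q ^ 5) ^ i))
     * (\<Prod>i<n. (1 - q ^ (5*i+1)) * (1 - q ^ (5*i+4)))"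
proof (induction n)
  case (Suc n)
  have "5 * Suc n = Suc (Suc (Suc (Suc (Suc (5 * n)))))"
    by simp
  then have 1: "qfac q (5 * Suc n) = qfac q (5 * n)
      * (1 - q ^ (5*n+1)) * (1 - q ^ (5*n+2)) * (1 - q ^ (5*n+3)) * (1 - q ^ (5*n+4)) * (1 - q ^ (5*n+5))"
    by (simp only: qfac_Suc) (simp add: eval_nat_numeral)
  have 2: "q ^ 3 * (q ^ 5) ^ n = q ^ (5*n+3)" "q ^ 2 * (q ^ 5) ^ n = q ^ (5*n+2)"
      "(q ^ 5) ^ Suc n = q ^ (5*n+5)"
    by (simp_all only: power_add power_mult) (simp_all only: power_Suc mult.commute)
  show ?case
    unfolding 1 Suc.IH qfac_Suc prod.lessThan_Suc 2 by (simp only: mult_ac)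
qed simp

text \<open>The triple product in base \<open>q^5\<close> at \<open>z = q^3\<close>,
  \<open>z' = q^2\<close>. The theta coefficients match because
  \<open>2 * j^2 = 4 * (j choose 2) + 2 * j\<close>.\<close>

lemma rogers_ramanujan_theta:
  "fps_cong N (\<Sum>j<N. fps_X ^ (2 * j\<^sup>2) * X.theta_coeff 1 (fps_X :: 'a::idom fps) j)
     (qfac (fps_X ^ 5) N * (\<Prod>i<N. (1 - fps_X ^ 3 * (fps_X ^ 5) ^ i) * (1 - fps_X ^ 2 * (fps_X ^ 5) ^ i)))"
    (is "fps_cong N (\<Sum>j<N. ?\<theta> j) (?Q N * (\<Prod>i<N. ?p i))")
proof -
  have q: "fps_X ^ 3 * fps_X ^ 2 = (fps_X ^ 5 :: 'a fps)"
    by (simp flip: power_add)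
  have theta: "X5.theta_coeff (fps_X ^ 3) (fps_X ^ 2) = ?\<theta>"
  proof
    fix j
    have "fps_X ^ (2 * j\<^sup>2) = (fps_X ^ (4 * (j choose 2) + 2 * j) :: 'a fps)"
      by (simp add: power2_eq_square square_eq_choose_2)
    then show "X5.theta_coeff (fps_X ^ 3) (fps_X ^ 2) j = ?\<theta> j"
    proof (cases "j = 0")
      case False
      then show ?thesis
        unfolding X5.theta_coeff_def X.theta_coeff_def \<open>fps_X ^ (2 * j\<^sup>2) = _\<close>
        by (simp add: algebra_simps flip: power_mult power_add)
    qed (simp add: X5.theta_coeff_def X.theta_coeff_def)
  qed
  have "fps_X ^ j dvd ?\<theta> j" for j
    by (intro dvd_mult2 le_imp_power_dvd) (simp add: power2_eq_square)
  then have "fps_cong N (?Q (2 * (2 * N)) * X5.bailey ?\<theta> (2 * N)) (?Q N * ((\<Sum>j<N. ?\<theta> j) * (X5.u N)\<^sup>2))"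
    by (intro fps_cong_mult fps_cong_qfac fps_cong_bailey) auto
  moreover have "?Q (2 * (2 * N)) * X5.bailey ?\<theta> (2 * N) = (\<Prod>i<2*N. ?p i)"
    using X5.bailey_theta[OF q, of "2 * N"] unfolding theta .
  moreover have "?Q N * ((\<Sum>j<N. ?\<theta> j) * (X5.u N)\<^sup>2) = (X5.u N * ?Q N) * (\<Sum>j<N. ?\<theta> j) * X5.u N"
    by (simp only: power2_eq_square mult_ac)
  ultimately have "fps_cong N (\<Prod>i<2*N. ?p i) ((\<Sum>j<N. ?\<theta> j) * X5.u N)"
    by simp
  moreover have "fps_cong N (\<Prod>i<2*N. ?p i) (\<Prod>i<N. ?p i)"
  proof (rule fps_cong_prod_truncate)
    fix i assume "N \<le> i"
    then have "fps_cong N (?p i) (1 * 1)"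
      unfolding power_mult[symmetric] power_add[symmetric]
      by (intro fps_cong_mult fps_cong_one_minus_X_power) auto
    then show "fps_cong N (?p i) 1"
      by simp
  qed simp
  \<comment> \<open>One factor \<open>X5.u N\<close> was cancelled by the prefactor; multiplying by
    \<open>?Q N\<close> removes the other.\<close>
  ultimately have "fps_cong N (?Q N * ((\<Sum>j<N. ?\<theta> j) * X5.u N)) (?Q N * (\<Prod>i<N. ?p i))"
    by (meson fps_cong_mult fps_cong_refl fps_cong_sym fps_cong_trans)
  moreover have "?Q N * ((\<Sum>j<N. ?\<theta> j) * X5.u N) = (X5.u N * ?Q N) * (\<Sum>j<N. ?\<theta> j)"
    by (simp only: mult_ac)
  ultimately show ?thesis
    by simp
qed

theorem rogers_ramanujan_cong:
  "fps_cong N ((\<Sum>s<N. fps_X ^ s\<^sup>2 * qfac_inv fps_X s)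
      * (\<Prod>i<N. (1 - fps_X ^ (5*i+1)) * (1 - fps_X ^ (5*i+4)))) (1 :: 'a::idom fps)"
proof -
  define S where "S = (\<Sum>s<N. fps_X ^ s\<^sup>2 * X.u s :: 'a fps)"
  define \<theta> where "\<theta> = (\<lambda>j. fps_X ^ (2 * j\<^sup>2) * X.theta_coeff 1 (fps_X :: 'a fps) j)"
  define Q where "Q = qfac (fps_X :: 'a fps)"
  let ?P = "\<Prod>i<N. (1 - fps_X ^ (5*i+1)) * (1 - fps_X ^ (5*i+4)) :: 'a fps"
  have uQ: "X.u N * Q N = 1"
    by (simp add: Q_def)
  have "fps_cong N (\<Sum>s\<le>2*N. fps_X ^ s\<^sup>2 * X.u s * X.u (2 * N - s)) (S * X.u N)"
    unfolding S_def
  proof (rule fps_cong_sum_truncate)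
    show "fps_X ^ s dvd fps_X ^ s\<^sup>2 * (X.u s :: 'a fps)" for s
      by (intro dvd_mult2 le_imp_power_dvd) (simp add: power2_eq_square)
    show "fps_cong N (X.u (2 * N - s)) (X.u N :: 'a fps)" if "s < N" for s
      using fps_cong_qfac_inv[of N "2 * N - s" 1, where 'a = 'a] \<open>s < N\<close> by (simp del: not_less)
  qed simp
  then have "fps_cong N (S * X.u N) (X.bailey \<theta> (2 * N))"
    by (simp only: X.finite_rogers_ramanujan \<theta>_def fps_cong_sym)
  also have "fps_X ^ j dvd \<theta> j" for j
    unfolding \<theta>_def by (intro dvd_mult2 le_imp_power_dvd) (simp add: power2_eq_square)
  then have "fps_cong N (X.bailey \<theta> (2 * N)) ((\<Sum>j<N. \<theta> j) * (X.u N)\<^sup>2)"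
    using fps_cong_bailey[of 1 \<theta> N] by simp
  \<comment> \<open>The multiplier \<open>Q N\<close> cancels one \<open>X.u N\<close> on each side;
    on the right a second one remains.\<close>
  finally have "fps_cong N (S * X.u N * (Q N * ?P)) ((\<Sum>j<N. \<theta> j) * (X.u N)\<^sup>2 * (Q N * ?P))"
    by (rule fps_cong_mult[OF _ fps_cong_refl])
  moreover have "S * X.u N * (Q N * ?P) = X.u N * Q N * (S * ?P)"
      "(\<Sum>j<N. \<theta> j) * (X.u N)\<^sup>2 * (Q N * ?P) = X.u N * Q N * (X.u N * ?P * (\<Sum>j<N. \<theta> j))"
    by (simp_all only: power2_eq_square mult_ac)
  ultimately have "fps_cong N (S * ?P) (X.u N * ?P * (\<Sum>j<N. \<theta> j))"
    unfolding uQ by (simp only: mult_1_left)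
  also have "fps_cong N \<dots> (X.u N * ?P
      * (qfac (fps_X ^ 5) N * (\<Prod>i<N. (1 - fps_X ^ 3 * (fps_X ^ 5) ^ i) * (1 - fps_X ^ 2 * (fps_X ^ 5) ^ i))))"
    unfolding \<theta>_def by (intro fps_cong_mult fps_cong_refl rogers_ramanujan_theta)
  \<comment> \<open>The product from the theta series supplies residues 0, 2, 3 modulo 5 and
    \<open>?P\<close> supplies 1, 4. Together they give all factors up to
    \<open>5 * N\<close>.\<close>
  also have "\<dots> = X.u N * Q (5 * N)"
    unfolding Q_def qfac_5_dissection by (simp only: mult_ac)
  also have "fps_cong N \<dots> (X.u N * Q N)"
    unfolding Q_def using fps_cong_qfac[of N "5 * N" 1] by (intro fps_cong_mult) auto
  finally show ?thesis
    unfolding uQ S_def .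
qed

text \<open>One series \<open>R\<close> represents both sides to every order; both the infinite sum
  and the infinite product of the final identity are evaluated through it.\<close>

corollary rogers_ramanujan_limit:
  obtains R :: "'a::idom fps"
  where "\<And>N. fps_cong N (\<Sum>s<N. fps_X ^ s\<^sup>2 * qfac_inv fps_X s) R"
    and "\<And>N. fps_cong N (R * (\<Prod>i<N. (1 - fps_X ^ (5*i+1)) * (1 - fps_X ^ (5*i+4)))) 1"
proof -
  have "fps_X ^ s dvd fps_X ^ s\<^sup>2 * qfac_inv (fps_X :: 'a fps) s" for s
    by (intro dvd_mult2 le_imp_power_dvd) (simp add: power2_eq_square)
  then obtain R where R: "\<And>N. fps_cong N (\<Sum>s<N. fps_X ^ s\<^sup>2 * qfac_inv (fps_X :: 'a fps) s) R"
    by (rule fps_series_limit_exists) blast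
  moreover have "fps_cong N (R * (\<Prod>i<N. (1 - fps_X ^ (5*i+1)) * (1 - fps_X ^ (5*i+4)))) 1" for N
    using fps_cong_trans[OF fps_cong_mult[OF fps_cong_sym[OF R[of N]] fps_cong_refl] rogers_ramanujan_cong] .
  ultimately show thesis
    by (rule that)
qed

lemma fps_cong_fraction:
  assumes "fps_cong N (f * g) h" "fps_nth g 0 = 1"
  shows "fps_cong N f (h \<oslash> g)"
proof -
  have "fps_cong N (f * g * (1 \<oslash> g)) (h * (1 \<oslash> g))"
    by (intro fps_cong_mult assms(1) fps_cong_refl)
  moreover have "f * g * (1 \<oslash> g) = f"
    using fps_fraction_mult_cancel[OF assms(2), of 1] by (simp add: mult_ac)
  ultimately show ?thesis
    by (simp add: fps_fraction_def)
qed

section \<open>The identity\<close>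

lemma fps_fraction_extend:
  assumes "g * e = D" "fps_nth g 0 = 1" "fps_nth D 0 = 1"
  shows "f \<oslash> g = f * e * (1 \<oslash> D)"
proof (rule fps_fraction_eqI)
  have "f * e * (1 \<oslash> D) * g = f * ((1 \<oslash> D) * (g * e))"
    by (simp only: mult_ac)
  then show "f * e * (1 \<oslash> D) * g = f"
    by (simp add: assms fps_fraction_mult_cancel)
qed fact

text \<open>The numerator of the first five terms over \<open>D\<close>. The parameters cancel in
  the order \<open>t\<close>, \<open>w\<close>, \<open>v\<close>, \<open>x\<close>; the squares
  \<open>v^2\<close> and \<open>x^2\<close> meet those from \<open>(1 + v*q^6) * (1 - v*q^6)\<close>
  and \<open>(1 + x*q^9) * (1 - x*q^9)\<close>.\<close>

lemma head_identity:
  fixes q t w v x :: "'a::comm_ring_1"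
  defines "E4 \<equiv> 1 - w * q^4" and "E6 \<equiv> 1 - v * q^6" and "E9 \<equiv> 1 - x * q^9"
  shows "(1 - t * q) * E4 * E6 * E9 + q * (t * (E4 * E6 * E9)) + q^4 * ((w + v * q^2) * (E6 * E9))
     + q^9 * ((x + q^2 + v^2 * q^3 + q^5) * E9)
     + q^16 * (1 + x^2 * q^2 + q^3 + x * q^4 + q^5 + q^6 + x * q^7 + q^8 + q^10)
   = 1 + q^11 + q^14 + q^16 + q^19 + q^21 + q^22 + q^24 + q^26"
proof -
  have 1: "(1 - t * q) * E4 * E6 * E9 + q * (t * (E4 * E6 * E9)) = E4 * E6 * E9"
    by (simp add: algebra_simps)
  have 2: "E4 * E6 * E9 + q^4 * ((w + v * q^2) * (E6 * E9)) = (1 + v * q^6) * E6 * E9"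
    by (simp add: E4_def algebra_simps flip: power_add)
  have 3: "(1 + v * q^6) * E6 = 1 - v^2 * q^12"
    by (simp add: E6_def power2_eq_square algebra_simps flip: power_add)
  have "q^3 * (v^2 * q^9) = v^2 * q^12"
    by (simp add: mult.left_commute[of "q^3"] flip: power_add)
  then have 4: "(1 - v^2 * q^12) * E9 + q^9 * ((x + q^2 + v^2 * q^3 + q^5) * E9) = (1 + x * q^9 + q^11 + q^14) * E9"
    by (simp add: algebra_simps flip: power_add)
  have 5: "(1 + x * q^9 + q^11 + q^14) * E9
      + q^16 * (1 + x^2 * q^2 + q^3 + x * q^4 + q^5 + q^6 + x * q^7 + q^8 + q^10)
      = 1 + q^11 + q^14 + q^16 + q^19 + q^21 + q^22 + q^24 + q^26"
    by (simp add: E9_def power2_eq_square[of x] algebra_simps flip: power_add)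
  show ?thesis
    unfolding 1 2 3 4 5 ..
qed

text \<open>The same polynomial arises from the first five Rogers--Ramanujan terms: the second
  factor is their sum multiplied by \<open>(q;q)_4\<close>.\<close>

lemma head_identity_gauss:
  fixes q :: "'a::comm_ring_1"
  shows "(1 + q^2 + q^3 + q^4 + q^5 + q^6 + q^7 + q^8 + q^10) *
     ((1 - q) * (1 - q^2) * (1 - q^3) * (1 - q^4) + q * ((1 - q^2) * (1 - q^3) * (1 - q^4))
      + q^4 * ((1 - q^3) * (1 - q^4)) + q^9 * (1 - q^4) + q^16)
   = 1 + q^11 + q^14 + q^16 + q^19 + q^21 + q^22 + q^24 + q^26"
  by (simp add: algebra_simps flip: power_add)

text \<open>The first factor is \<open>(1 + q^2 + q^4) * (1 + q^3 + q^6)\<close>, that is,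
  \<open>(1 - q^6) * (1 - q^9)\<close> divided by \<open>(1 - q^2) * (1 - q^3)\<close>.\<close>

lemma numerator_identity:
  fixes q :: "'a::comm_ring_1"
  shows "(1 + q^2 + q^3 + q^4 + q^5 + q^6 + q^7 + q^8 + q^10) * ((1 - q) * (1 - q^2) * (1 - q^3) * (1 - q^4))
    = (1 - q) * (1 - q^4) * (1 - q^6) * (1 - q^9)"
  by (simp add: algebra_simps flip: power_add)


text \<open>The parameters are arbitrary power series: in \<open>D\<close> each is multiplied by a
  positive power of \<open>q\<close>, so \<open>D\<close> has constant coefficient 1 and is
  invertible.\<close>

theorem rogers_ramanujan_indeterminates:
  fixes t w v x :: "'a::idom fps"
  defines "q \<equiv> fps_X"
  defines "P \<equiv> 1 + q^2 + q^3 + q^4 + q^5 + q^6 + q^7 + q^8 + q^10"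
    and "D \<equiv> (1 - t * q) * (1 - w * q^4) * (1 - v * q^6) * (1 - x * q^9)"
    and "a \<equiv> \<lambda>m::nat. q^(m^2) \<oslash>
               ((1 - t * q) * (1 - q^2) * (1 - q^3) * (1 - w * q^4) * (1 - q^5) * (1 - v * q^6)
                 * (1 - q^7) * (1 - q^8) * (1 - x * q^9) * (\<Prod>i=10..m. (1 - q^i)))"
    and "b \<equiv> \<lambda>k::nat. 1 \<oslash> ((1 - q^(5*k+1)) * (1 - q^(5*k+4)))"
  shows "summable (\<lambda>n. a (n + 9))" (is ?summable)
    and "convergent_prod (\<lambda>n. b (n + 2))" (is ?convergent)
    and "1 + q * (t \<oslash> (1 - t * q))
          + q^4 * ((w + v * q^2) \<oslash> ((1 - t * q) * (1 - w * q^4)))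
          + q^9 * ((x + q^2 + v^2 * q^3 + q^5) \<oslash> ((1 - t * q) * (1 - w * q^4) * (1 - v * q^6)))
          + q^16 * ((1 + x^2 * q^2 + q^3 + x * q^4 + q^5 + q^6 + x * q^7 + q^8 + q^10) \<oslash> D)
          + q^25 * (P \<oslash> (D * (1 - q^5)))
          + q^36 * (P \<oslash> (D * (1 - q^5) * (1 - q^6)))
          + q^49 * (P \<oslash> (D * (1 - q^5) * (1 - q^6) * (1 - q^7)))
          + q^64 * (P \<oslash> (D * (1 - q^5) * (1 - q^6) * (1 - q^7) * (1 - q^8)))
          + (\<Sum>n. a (n + 9))
        = (1 \<oslash> D) * (\<Prod>n. b (n + 2))" (is "?head + _ = _")
proof -
  define Dinv where "Dinv = 1 \<oslash> D"
  \<comment> \<open>\<open>C\<close> is \<open>D\<close> with all four parameters set to 1.\<close>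
  define C where "C = (1 - q) * (1 - q^4) * (1 - q^6) * (1 - q^9)"
  define U where "U m = q ^ m\<^sup>2 * X.u m" for m
  obtain R :: "'a fps" where R: "\<And>N. fps_cong N (\<Sum>s<N. U s) R"
    and RP: "\<And>N. fps_cong N (R * (\<Prod>i<N. (1 - q ^ (5*i+1)) * (1 - q ^ (5*i+4)))) 1"
    unfolding U_def q_def by (rule rogers_ramanujan_limit) blast
  have nth_0: "fps_nth (q ^ n) 0 = (if n = 0 then 1 else 0)" "fps_nth q 0 = 0" for n
    by (simp_all add: q_def fps_X_power_nth)
  have D0: "fps_nth D 0 = 1"
    by (simp add: D_def nth_0)
  have DinvD: "Dinv * D = 1"
    unfolding Dinv_def by (rule fps_fraction_mult_cancel[OF D0])
  have uq: "X.u m * qfac q m = 1" for m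
    unfolding q_def by (rule X.u_mult_qfac)

  \<comment> \<open>Cross-multiplied criterion for \<open>f / (D * g)\<close> to equal
    \<open>C / D\<close> times \<open>1 / (q;q)_m\<close>.\<close>
  have term_eq: "q ^ m\<^sup>2 * (f \<oslash> (D * g)) = Dinv * C * U m" if "C * g = f * qfac q m" "fps_nth g 0 = 1" for f g m
  proof -
    have "Dinv * C * X.u m * (D * g) = (Dinv * D) * X.u m * (C * g)"
      by (simp only: mult_ac)
    also have "\<dots> = (Dinv * D) * (X.u m * qfac q m) * f"
      by (simp only: that(1) mult_ac)
    finally have "f \<oslash> (D * g) = Dinv * C * X.u m"
      by (intro fps_fraction_eqI) (simp_all add: DinvD uq D0 that(2))
    then show ?thesis
      by (simp only: U_def mult_ac)
  qed

  have qfac_simps: "qfac q 5 = qfac q 4 * (1 - q^5)" "qfac q 6 = qfac q 5 * (1 - q^6)"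
      "qfac q 7 = qfac q 6 * (1 - q^7)" "qfac q 8 = qfac q 7 * (1 - q^8)" "qfac q 9 = qfac q 8 * (1 - q^9)"
    using qfac_Suc[of q 4] qfac_Suc[of q 5] qfac_Suc[of q 6] qfac_Suc[of q 7] qfac_Suc[of q 8] by simp_all
  have qfac_4: "qfac q 4 = (1 - q) * (1 - q^2) * (1 - q^3) * (1 - q^4)"
    by (simp add: qfac_def numeral_eq_Suc)
  have PC: "P * qfac q 4 = C"
    unfolding qfac_4 P_def C_def by (rule numerator_identity)
  have mid: "q^25 * (P \<oslash> (D * (1 - q^5))) = Dinv * C * U 5"
       "q^36 * (P \<oslash> (D * (1 - q^5) * (1 - q^6))) = Dinv * C * U 6"
       "q^49 * (P \<oslash> (D * (1 - q^5) * (1 - q^6) * (1 - q^7))) = Dinv * C * U 7"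
       "q^64 * (P \<oslash> (D * (1 - q^5) * (1 - q^6) * (1 - q^7) * (1 - q^8))) = Dinv * C * U 8"
    using term_eq[of "1 - q^5" P 5] term_eq[of "(1 - q^5) * (1 - q^6)" P 6]
      term_eq[of "(1 - q^5) * (1 - q^6) * (1 - q^7)" P 7]
      term_eq[of "(1 - q^5) * (1 - q^6) * (1 - q^7) * (1 - q^8)" P 8] PC
    by (simp_all add: qfac_simps nth_0 mult.assoc)
  have tail: "a m = Dinv * C * U m" if "9 \<le> m" for m
  proof -
    define Y where "Y = (\<Prod>i=10..m. 1 - q ^ i)"
    have qfac_m: "qfac q m = qfac q 9 * Y"
      unfolding Y_def using that
    proof (induction m rule: dec_induct)
      case (step m)
      then show ?case
        by (simp add: qfac_Suc mult.assoc)
    qed simp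
    \<comment> \<open>The denominator of \<open>a m\<close> without the four factors of
      \<open>D\<close>; restoring the factors of \<open>C\<close> completes it to
      \<open>qfac q m\<close>.\<close>
    define g where "g = (1 - q^2) * (1 - q^3) * (1 - q^5) * (1 - q^7) * (1 - q^8) * Y"
    have "C * g = 1 * qfac q m"
      unfolding qfac_m qfac_simps qfac_4 C_def g_def by (simp only: mult_ac mult_1_left)
    moreover have "fps_nth g 0 = 1"
      by (simp add: g_def Y_def nth_0 fps_nth_0_prod)
    ultimately have "q ^ m\<^sup>2 * (1 \<oslash> (D * g)) = Dinv * C * U m"
      by (rule term_eq)
    moreover have "D * g = (1 - t * q) * (1 - q^2) * (1 - q^3) * (1 - w * q^4) * (1 - q^5) * (1 - v * q^6)
        * (1 - q^7) * (1 - q^8) * (1 - x * q^9) * Y"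
      unfolding D_def g_def by (simp only: mult_ac)
    ultimately show ?thesis
      by (simp add: a_def Y_def fps_fraction_def)
  qed
  have head: "1 + q * (t \<oslash> (1 - t * q))
          + q^4 * ((w + v * q^2) \<oslash> ((1 - t * q) * (1 - w * q^4)))
          + q^9 * ((x + q^2 + v^2 * q^3 + q^5) \<oslash> ((1 - t * q) * (1 - w * q^4) * (1 - v * q^6)))
          + q^16 * ((1 + x^2 * q^2 + q^3 + x * q^4 + q^5 + q^6 + x * q^7 + q^8 + q^10) \<oslash> D)
        = Dinv * C * (\<Sum>s<5. U s)"
  proof -
    define E4 E6 E9 where "E4 = 1 - w * q^4" and "E6 = 1 - v * q^6" and "E9 = 1 - x * q^9"
    have D: "D = (1 - t * q) * E4 * E6 * E9"
      by (simp add: D_def E4_def E6_def E9_def)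
    have E0: "fps_nth E4 0 = 1" "fps_nth E6 0 = 1" "fps_nth E9 0 = 1" "fps_nth (1 - t * q) 0 = 1"
      by (simp_all add: E4_def E6_def E9_def nth_0)
    have f: "t \<oslash> (1 - t * q) = t * (E4 * E6 * E9) * Dinv"
      "(w + v * q^2) \<oslash> ((1 - t * q) * E4) = (w + v * q^2) * (E6 * E9) * Dinv"
      "(x + q^2 + v^2 * q^3 + q^5) \<oslash> ((1 - t * q) * E4 * E6) = (x + q^2 + v^2 * q^3 + q^5) * E9 * Dinv"
      unfolding Dinv_def
      by - (rule fps_fraction_extend; simp add: D E0 nth_0 mult.assoc)+
    have g: "f \<oslash> D = f * Dinv" for f
      by (simp add: Dinv_def fps_fraction_def)
    \<comment> \<open>With \<open>C = P * qfac q 4\<close>, each product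
      \<open>qfac q 4 * X.u s\<close> keeps only the factors \<open>1 - q ^ i\<close> with
      \<open>s < i \<le> 4\<close>.\<close>
    have "C * (\<Sum>s<5. U s) = P * (qfac q 4 * X.u 0 + q * (qfac q 4 * X.u 1) + q^4 * (qfac q 4 * X.u 2)
        + q^9 * (qfac q 4 * X.u 3) + q^16 * (qfac q 4 * X.u 4))"
      unfolding PC[symmetric] by (simp add: U_def numeral_eq_Suc algebra_simps)
    also have "qfac q 4 * X.u 0 = (1 - q) * (1 - q^2) * (1 - q^3) * (1 - q^4) * (X.u 0 * qfac q 0)"
      by (simp add: qfac_4)
    also have "qfac q 4 * X.u 1 = (1 - q^2) * (1 - q^3) * (1 - q^4) * (X.u 1 * qfac q 1)"
      unfolding qfac_4 by (simp add: qfac_def mult_ac)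
    also have "qfac q 4 * X.u 2 = (1 - q^3) * (1 - q^4) * (X.u 2 * qfac q 2)"
      unfolding qfac_4 by (simp add: qfac_def numeral_eq_Suc mult_ac)
    also have "qfac q 4 * X.u 3 = (1 - q^4) * (X.u 3 * qfac q 3)"
      unfolding qfac_4 by (simp add: qfac_def numeral_eq_Suc mult_ac)
    also have "qfac q 4 * X.u 4 = X.u 4 * qfac q 4"
      by (rule mult.commute)
    finally have "C * (\<Sum>s<5. U s) = 1 + q^11 + q^14 + q^16 + q^19 + q^21 + q^22 + q^24 + q^26"
      unfolding uq P_def mult_1_right head_identity_gauss .
    \<comment> \<open>\<open>head_identity\<close> has the same right-hand side, which brings the
      parameters back in.\<close>
    then have "Dinv * C * (\<Sum>s<5. U s) = Dinv * (D + q * (t * (E4 * E6 * E9)) + q^4 * ((w + v * q^2) * (E6 * E9))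
       + q^9 * ((x + q^2 + v^2 * q^3 + q^5) * E9)
       + q^16 * (1 + x^2 * q^2 + q^3 + x * q^4 + q^5 + q^6 + x * q^7 + q^8 + q^10))"
      unfolding mult.assoc[of Dinv] D E4_def E6_def E9_def head_identity by (rule arg_cong)
    also have "\<dots> = 1 + q * (t * (E4 * E6 * E9) * Dinv) + q^4 * ((w + v * q^2) * (E6 * E9) * Dinv)
       + q^9 * ((x + q^2 + v^2 * q^3 + q^5) * E9 * Dinv)
       + q^16 * ((1 + x^2 * q^2 + q^3 + x * q^4 + q^5 + q^6 + x * q^7 + q^8 + q^10) * Dinv)"
      unfolding distrib_left[of Dinv] DinvD by (simp only: mult_ac)
    finally show ?thesis
      unfolding f[symmetric] unfolding g[symmetric] E4_def E6_def by (rule sym)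
  qed
  have head': "?head = Dinv * C * (\<Sum>s<9. U s)"
    unfolding head mid by (simp add: eval_nat_numeral(2-) numeral_eq_Suc algebra_simps)

  have "(\<lambda>n. a (n + 9)) sums (Dinv * C * (R - (\<Sum>s<9. U s)))"
    unfolding sums_def
  proof (rule tendsto_fps_congI)
    fix N
    have "(\<Sum>n<N. a (n + 9)) = Dinv * C * (\<Sum>n<N. U (n + 9))"
      by (simp add: tail sum_distrib_left)
    also have "(\<Sum>n<N. U (n + k)) = (\<Sum>s<N+k. U s) - (\<Sum>s<k. U s)" for k
      by (induction N) simp_all
    finally have "(\<Sum>n<N. a (n + 9)) = Dinv * C * ((\<Sum>s<N+9. U s) - (\<Sum>s<9. U s))" .
    moreover have "fps_cong N (\<Sum>s<N+9. U s) R"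
      using R by (rule fps_cong_mono) simp
    ultimately show "fps_cong N (\<Sum>n<N. a (n + 9)) (Dinv * C * (R - (\<Sum>s<9. U s)))"
      by (simp add: fps_cong_mult fps_cong_diff)
  qed
  then have ?summable and suminf: "(\<Sum>n. a (n + 9)) = Dinv * C * (R - (\<Sum>s<9. U s))"
    by (auto simp: sums_iff)

  define p where "p i = (1 - q ^ (5*i+1)) * (1 - q ^ (5*i+4))" for i
  have p0: "fps_nth (p i) 0 = 1" for i
    by (simp add: p_def nth_0)
  have bp: "b i * p i = 1" for i
    unfolding b_def p_def[symmetric] by (rule fps_fraction_mult_cancel[OF p0])
  \<comment> \<open>The product starts at \<open>k = 2\<close>; the missing factors for
    \<open>k = 0\<close> and \<open>k = 1\<close> multiply to \<open>C\<close>, whence the value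
    \<open>C * R\<close>.\<close>
  have "raw_has_prod (\<lambda>n. b (n + 2)) 0 (C * R)"
    unfolding raw_has_prod_def
  proof
    \<comment> \<open>Convergence of an infinite product includes a nonzero limit, which the
      constant coefficient shows.\<close>
    have "fps_nth R 0 = 1"
      using RP[of 1] p0[of 0] by (simp add: fps_cong_iff p_def)
    moreover have "fps_nth C 0 = 1"
      by (simp add: C_def nth_0)
    ultimately show "C * R \<noteq> 0"
      by auto
    show "(\<lambda>n. \<Prod>i\<le>n. b (i + 0 + 2)) \<longlonglongrightarrow> C * R"
    proof (rule tendsto_fps_congI)
      fix N
      have "(\<Prod>i\<le>N. b (i + 0 + 2)) * (\<Prod>i\<le>N. p (i + 2)) = (\<Prod>i\<le>N. b (i + 2) * p (i + 2))"
        by (simp add: prod.distrib)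
      also have "\<dots> = 1"
        by (simp add: bp)
      finally have 1: "(\<Prod>i\<le>N. b (i + 0 + 2)) = 1 \<oslash> (\<Prod>i\<le>N. p (i + 2))"
        by (intro fps_fraction_eqI[symmetric]) (simp_all add: fps_nth_0_prod p0)
      have "(\<Prod>i<k. p i) * (\<Prod>i<M. p (i + k)) = (\<Prod>i<M+k. p i)" for k M
        by (induction M) (simp_all flip: mult.assoc)
      \<comment> \<open>The bound \<open>N + 3\<close> is two initial factors plus the
        \<open>Suc N\<close> indices \<open>i \<le> N\<close>.\<close>
      from this[of 2 "Suc N"] have "(\<Prod>i<2. p i) * (\<Prod>i\<le>N. p (i + 2)) = (\<Prod>i<N+3. p i)"
        by (simp add: lessThan_Suc_atMost numeral_3_eq_3)
      moreover have "(\<Prod>i<2. p i) = C"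
        by (simp add: p_def C_def numeral_eq_Suc mult_ac)
      ultimately have "C * R * (\<Prod>i\<le>N. p (i + 2)) = R * (\<Prod>i<N+3. p i)"
        by (metis mult.assoc mult.commute)
      moreover have "fps_cong N (R * (\<Prod>i<N+3. p i)) 1"
        using RP[of "N + 3"] unfolding p_def by (rule fps_cong_mono) simp
      ultimately have "fps_cong N (C * R * (\<Prod>i\<le>N. p (i + 2))) 1"
        by (simp only:)
      then have "fps_cong N (C * R) (1 \<oslash> (\<Prod>i\<le>N. p (i + 2)))"
        by (intro fps_cong_fraction) (simp_all add: fps_nth_0_prod p0)
      then show "fps_cong N (\<Prod>i\<le>N. b (i + 0 + 2)) (C * R)"
        unfolding 1 by (rule fps_cong_sym)
    qed
  qed
  then have ?convergent and "(\<lambda>n. b (n + 2)) has_prod (C * R)"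
    unfolding convergent_prod_def has_prod_def by blast+
  then have prodinf: "(\<Prod>n. b (n + 2)) = C * R"
    using has_prod_unique by metis
  show ?summable ?convergent
    by fact+
  \<comment> \<open>The partial sums of \<open>U\<close> below 9 cancel, and both sides are
    \<open>Dinv * C * R\<close>.\<close>
  show "?head + (\<Sum>n. a (n + 9)) = (1 \<oslash> D) * (\<Prod>n. b (n + 2))"
    unfolding head' suminf prodinf Dinv_def[symmetric] by (simp add: algebra_simps)
qed

theorem theorem7:
  shows
    "let q = (fps_X :: Z_twvx fps);
         t = fps_const indet_t; w = fps_const indet_w;
         v = fps_const indet_v; x = fps_const indet_x;
         P = 1 + q^2 + q^3 + q^4 + q^5 + q^6 + q^7 + q^8 + q^10;
         D = (1 - t * q) * (1 - w * q^4) * (1 - v * q^6) * (1 - x * q^9);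
         a = (\<lambda>m::nat. q^(m^2) \<oslash>
               ((1 - t * q) * (1 - q^2) * (1 - q^3) * (1 - w * q^4) * (1 - q^5) * (1 - v * q^6)
                 * (1 - q^7) * (1 - q^8) * (1 - x * q^9) * (\<Prod>i=10..m. (1 - q^i))));
         b = (\<lambda>k::nat. 1 \<oslash> ((1 - q^(5*k+1)) * (1 - q^(5*k+4))))
     in summable (\<lambda>n. a (n + 9)) \<and> convergent_prod (\<lambda>n. b (n + 2)) \<and>
        1 + q * (t \<oslash> (1 - t * q))
          + q^4 * ((w + v * q^2) \<oslash> ((1 - t * q) * (1 - w * q^4)))
          + q^9 * ((x + q^2 + v^2 * q^3 + q^5) \<oslash> ((1 - t * q) * (1 - w * q^4) * (1 - v * q^6)))
          + q^16 * ((1 + x^2 * q^2 + q^3 + x * q^4 + q^5 + q^6 + x * q^7 + q^8 + q^10) \<oslash> D)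
          + q^25 * (P \<oslash> (D * (1 - q^5)))
          + q^36 * (P \<oslash> (D * (1 - q^5) * (1 - q^6)))
          + q^49 * (P \<oslash> (D * (1 - q^5) * (1 - q^6) * (1 - q^7)))
          + q^64 * (P \<oslash> (D * (1 - q^5) * (1 - q^6) * (1 - q^7) * (1 - q^8)))
          + (\<Sum>n. a (n + 9))
        = (1 \<oslash> ((1 - t * q) * (1 - w * q^4) * (1 - v * q^6) * (1 - x * q^9)))
          * (\<Prod>n. b (n + 2))"
  \<comment> \<open>Iterated polynomials over the integers form an integral domain, and the
    indeterminates enter as constant series.\<close>
  unfolding Let_def by (intro conjI rogers_ramanujan_indeterminates)

end
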